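(* Let $\mathcal H$ and $\mathcal G$ be real Hilbert spaces, let $A\colon\mathcal H\to2^{\mathcal H}$ and $B\colon\mathcal G\to2^{\mathcal G}$ be maximally monotone operators, and let $L\colon\mathcal H\to\mathcal G$ be a bounded linear operator. Let $\mathscr P$, $\mathscr D$, $\boldsymbol Z$ be the primal solution set, dual solution set and Kuhn-Tucker set defined in the context. Suppose that $\mathscr P\neq\varnothing$, let $x_0\in\mathcal H$, let $v_0^*\in\mathcal G$, and iterate as follows for $n=0,1,\dots$: 1. Choose any $(a_n,a_n^* )\in\operatorname{gra}A$ and any $(b_n,b_n^* )\in\operatorname{gra}B$, and set $s_n^*=a_n^*+L^*b_n^*$, $\;t_n=b_n-La_n$, $\;\sigma_n=\sqrt{\|s_n^*\|^2+\|t_n\|^2}$. 2. If $\sigma_n=0$: set $\overline x=a_n$, $\overline v^*=b_n^*$, and terminate. 3. If $\sigma_n>0$: choose any $\lambda_n\in\left]0,2\right[$ and set $$\Delta_n=\max\big\{0,\big(\langle x_n\mid s_n^*\rangle+\langle t_n\mid v_n^*\rangle-\langle a_n\mid a_n^*\rangle-\langle b_n\mid b_n^*\rangle\big)/\sigma_n\big\},$$ $\theta_n=\lambda_n\Delta_n/\sigma_n$, $\;x_{n+1}=x_n-\theta_ns_n^*$, $\;v_{n+1}^*=v_n^*-\theta_nt_n$. Then either the iteration terminates in a finite number of steps at a point $(\overline x,\overline v^* )\in\boldsymbol Z$, or it generates infinite sequences $(x_n)_{n\in\mathbb N}$ and $(v_n^* )_{n\in\mathbb N}$ such that the following hold: (i)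 $(x_n,v_n^* )_{n\in\mathbb N}$ is Fejér monotone with respect to $\boldsymbol Z$. (ii) $\sum_{n\in\mathbb N}\lambda_n(2-\lambda_n)\Delta_n^2<+\infty$. (iii) Suppose that for every $x\in\mathcal H$, every $v^*\in\mathcal G$, and every strictly increasing sequence $(k_n)_{n\in\mathbb N}$ in $\mathbb N$, if $x_{k_n}\rightharpoonup x$ and $v^*_{k_n}\rightharpoonup v^*$, then $(x,v^* )\in\boldsymbol Z$. Then $(x_n)_{n\in\mathbb N}$ converges weakly to a point $\overline x\in\mathscr P$, $(v_n^* )_{n\in\mathbb N}$ converges weakly to a point $\overline v^*\in\mathscr D$, and $(\overline x,\overline v^* )\in\boldsymbol Z$.
   Context: $\operatorname{gra}M=\{(x,u)\mid u\in Mx\}$ denotes the graph of a set-valued operator $M$, and $M^{-1}$ its inverse: $x\in M^{-1}u\Leftrightarrow u\in Mx$. The symbol $\rightharpoonup$ denotes weak convergence, and $\mathcal H\oplus\mathcal G$ is the Hilbert direct sum. $\mathscr P=\{x\in\mathcal H\mid 0\in Ax+L^*BLx\}$, where $L^*BLx=\{L^*w\mid w\in B(Lx)\}$, is the primal solution set. $\mathscr D=\{v^*\in\mathcal G\mid 0\in-LA^{-1}(-L^*v^* )+B^{-1}v^*\}$ is the dual solution set, where $LA^{-1}(-L^*v^* )=\{Lu\mid u\in A^{-1}(-L^*v^* )\}$. The Kuhn-Tucker set is $\boldsymbol Z=\{(x,v^* )\in\mathcal H\oplus\mathcal G\mid -L^*v^*\in Ax\text{ and }Lx\in B^{-1}v^*\}$.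 A sequence $(\boldsymbol x_n)_{n\in\mathbb N}$ in a Hilbert space is Fejér monotone with respect to a set $\boldsymbol C$ if $\|\boldsymbol x_{n+1}-\boldsymbol z\|\le\|\boldsymbol x_n-\boldsymbol z\|$ for every $\boldsymbol z\in\boldsymbol C$ and every $n\in\mathbb N$. *)

theory Defs
  imports "HOL-Analysis.Analysis" "HOL-Library.Set_Algebras"
begin

text \<open>
  A real Hilbert space is a type of sort \<open>{real_inner, complete_space}\<close>; the product type with its
  library norm and inner product is then the Hilbert direct sum. A set-valued operator
  \<open>M : H \<rightarrow> 2\<^sup>H\<close> is a function of type \<open>'a \<Rightarrow> 'a set\<close>.

  The adjoint \<open>L\<^sup>*\<close> is the library constant \<^const>\<open>adjoint\<close>, which is given by Hilbert choice; on
  complete spaces and for bounded linear \<open>L\<close> the chosen function exists and is unique.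
\<close>

definition gra :: "('a \<Rightarrow> 'b set) \<Rightarrow> ('a \<times> 'b) set" where
  "gra M = {(x, u). u \<in> M x}"

definition op_inverse :: "('a \<Rightarrow> 'b set) \<Rightarrow> 'b \<Rightarrow> 'a set" where
  "op_inverse M u = {x. u \<in> M x}"

definition monotone_operator :: "('a::real_inner \<Rightarrow> 'a set) \<Rightarrow> bool" where
  "monotone_operator M \<longleftrightarrow>
     (\<forall>(x, u)\<in>gra M. \<forall>(y, v)\<in>gra M. 0 \<le> inner (x - y) (u - v))"

definition maximally_monotone :: "('a::real_inner \<Rightarrow> 'a set) \<Rightarrow> bool" where
  "maximally_monotone M \<longleftrightarrow>
     monotone_operator M \<and> \<not> (\<exists>N. monotone_operator N \<and> gra M \<subset> gra N)"

text \<open>Sums of sets, here and below, are Minkowski sums.\<close>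

definition primal_solutions ::
    "('a::real_inner \<Rightarrow> 'a set) \<Rightarrow> ('b::real_inner \<Rightarrow> 'b set) \<Rightarrow> ('a \<Rightarrow> 'b) \<Rightarrow> 'a set" where
  "primal_solutions A B L = {x. 0 \<in> A x + adjoint L ` B (L x)}"

definition dual_solutions ::
    "('a::real_inner \<Rightarrow> 'a set) \<Rightarrow> ('b::real_inner \<Rightarrow> 'b set) \<Rightarrow> ('a \<Rightarrow> 'b) \<Rightarrow> 'b set" where
  "dual_solutions A B L =
     {v. 0 \<in> uminus ` L ` op_inverse A (- adjoint L v) + op_inverse B v}"

definition kuhn_tucker ::
    "('a::real_inner \<Rightarrow> 'a set) \<Rightarrow> ('b::real_inner \<Rightarrow> 'b set) \<Rightarrow> ('a \<Rightarrow> 'b) \<Rightarrow> ('a \<times> 'b) set" where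
  "kuhn_tucker A B L = {(x, v). - adjoint L v \<in> A x \<and> L x \<in> op_inverse B v}"

definition fejer_monotone :: "(nat \<Rightarrow> 'a::real_normed_vector) \<Rightarrow> 'a set \<Rightarrow> bool" where
  "fejer_monotone x C \<longleftrightarrow> (\<forall>z\<in>C. \<forall>n. norm (x (Suc n) - z) \<le> norm (x n - z))"

text \<open>The weak topology of a Hilbert space is the one induced by the functionals \<open>inner _ y\<close>.\<close>

definition weakly_converges :: "(nat \<Rightarrow> 'a::real_inner) \<Rightarrow> 'a \<Rightarrow> bool" where
  "weakly_converges x l \<longleftrightarrow> (\<forall>y. (\<lambda>n. inner (x n) y) \<longlonglongrightarrow> inner l y)"

end

theory Submission
  imports Defs
begin

text \<open>
  By monotonicity of \<open>A\<close> and \<open>B\<close>, the half-space of all \<open>z\<close> with \<open>\<langle>z, d\<rangle> \<le> \<eta>\<close>, where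
  \<open>d = (s\<^sub>n\<^sup>*, t\<^sub>n)\<close> and \<open>\<eta> = \<langle>a\<^sub>n, a\<^sub>n\<^sup>*\<rangle> + \<langle>b\<^sub>n, b\<^sub>n\<^sup>*\<rangle>\<close>, contains the Kuhn-Tucker set. A step of the
  iteration is a relaxed projection onto this half-space, with \<open>\<Delta>\<^sub>n\<close> the distance to it, so the squared
  distance to every Kuhn-Tucker point drops by at least \<open>\<lambda>\<^sub>n (2 - \<lambda>\<^sub>n) \<Delta>\<^sub>n\<^sup>2\<close>. This gives Fejer
  monotonicity and summability; weak convergence follows because a Fejer monotone sequence is bounded
  and has at most one weak cluster point in the target set.
\<close>

section \<open>Riesz representation and weak sequential compactness\<close>

text \<open>A sequence in \<open>S\<close> minimizing the distance to \<open>x\<close> is Cauchy by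
  the parallelogram law. Its limit is a nearest point, and perturbing that point inside
  \<open>S\<close> gives the orthogonality.\<close>

lemma orthogonal_projection_exists:
  fixes S :: "'a::{real_inner, complete_space} set"
  assumes "subspace S" "closed S"
  obtains p where "p \<in> S" "\<And>y. y \<in> S \<Longrightarrow> inner (x - p) y = 0"
proof -
  define D where "D = (INF y\<in>S. (norm (x - y))\<^sup>2)"
  have "0 \<in> S" using assms(1) by (rule subspace_0)
  have bdd: "bdd_below ((\<lambda>y. (norm (x - y))\<^sup>2) ` S)"
    by (rule bdd_belowI[of _ 0]) auto
  have D_le: "D \<le> (norm (x - y))\<^sup>2" if "y \<in> S" for y
    unfolding D_def using bdd that by (rule cINF_lower)
  have "\<exists>y\<in>S. (norm (x - y))\<^sup>2 < D + 1 / Suc n" for n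
    using cINF_less_iff[OF _ bdd, of "D + 1 / Suc n"] \<open>0 \<in> S\<close> D_def by fastforce
  then obtain p where p_S: "\<And>n. p n \<in> S"
    and p_lt: "\<And>n. (norm (x - p n))\<^sup>2 < D + 1 / Suc n"
    by metis
  have p_diff: "(norm (p m - p n))\<^sup>2 \<le> 2 / Suc m + 2 / Suc n" for m n
  proof -
    \<comment> \<open>The midpoint of \<open>p m\<close> and \<open>p n\<close> is again in
      \<open>S\<close>, so its squared distance to \<open>x\<close> is at least \<open>D\<close>;
      the parallelogram identity then leaves little room for \<open>p m - p n\<close>.\<close>
    have "(1/2) *\<^sub>R (p m + p n) \<in> S"
      using p_S assms(1) by (intro subspace_scale subspace_add)
    from D_le[OF this]
    have "4 * D \<le> (norm (2 *\<^sub>R x - (p m + p n)))\<^sup>2"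
      by (simp add: power2_norm_eq_inner inner_simps inner_commute field_simps)
    moreover have "(norm (p m - p n))\<^sup>2 + (norm (2 *\<^sub>R x - (p m + p n)))\<^sup>2
        = 2 * (norm (x - p m))\<^sup>2 + 2 * (norm (x - p n))\<^sup>2"
      by (simp add: power2_norm_eq_inner inner_simps inner_commute)
    ultimately show ?thesis using p_lt[of m] p_lt[of n] by simp
  qed
  have "Cauchy p"
  proof (rule CauchyI)
    fix e :: real assume "e > 0"
    then obtain N where N: "1 / Suc N < e\<^sup>2 / 4"
      using nat_approx_posE[of "e\<^sup>2 / 4"] by auto
    have "norm (p m - p n) < e" if "m \<ge> N" "n \<ge> N" for m n
    proof (rule power2_less_imp_less)
      have "1 / Suc m \<le> 1 / Suc N" "1 / Suc n \<le> 1 / Suc N"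
        using that by (auto simp: frac_le)
      then show "(norm (p m - p n))\<^sup>2 < e\<^sup>2" using p_diff[of m n] N by simp
    qed (use \<open>e > 0\<close> in simp)
    then show "\<exists>M. \<forall>m\<ge>M. \<forall>n\<ge>M. norm (p m - p n) < e" by blast
  qed
  then obtain q where q: "p \<longlonglongrightarrow> q"
    using Cauchy_convergent convergent_def by blast
  have q_S: "q \<in> S" using closed_sequentially[OF assms(2) p_S q] .
  have "(norm (x - q))\<^sup>2 \<le> D + 0"
  proof (rule LIMSEQ_le)
    show "(\<lambda>n. (norm (x - p n))\<^sup>2) \<longlonglongrightarrow> (norm (x - q))\<^sup>2"
      by (intro tendsto_intros q)
    show "(\<lambda>n. D + 1 / Suc n) \<longlonglongrightarrow> D + 0"
      by (intro tendsto_intros LIMSEQ_Suc lim_1_over_n)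
  qed (use p_lt less_imp_le in blast)
  then have min: "(norm (x - q))\<^sup>2 \<le> (norm (x - y))\<^sup>2" if "y \<in> S" for y
    using D_le[OF that] by linarith
  have "inner (x - q) y = 0" if "y \<in> S" for y
  proof (cases "y = 0")
    case False
    \<comment> \<open>This \<open>c\<close> minimizes the norm of
      \<open>x - q - c *\<^sub>R y\<close> over all scalars, so comparison with the minimality of
      \<open>q\<close> is sharpest here.\<close>
    define c where "c = inner (x - q) y / inner y y"
    have "q + c *\<^sub>R y \<in> S"
      using q_S that assms(1) by (intro subspace_scale subspace_add)
    then have "inner (x - q) (x - q) \<le> inner (x - q - c *\<^sub>R y) (x - q - c *\<^sub>R y)"
      using min by (simp add: power2_norm_eq_inner diff_diff_eq)
    also have "\<dots> = inner (x - q) (x - q) - 2 * c * inner (x - q) y + c * (c * inner y y)"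
      by (simp add: inner_diff_left inner_diff_right inner_commute algebra_simps)
    also have "c * inner y y = inner (x - q) y"
      using False by (simp add: c_def)
    finally have "c * inner (x - q) y \<le> 0" by simp
    then have "(inner (x - q) y)\<^sup>2 / inner y y \<le> 0"
      by (simp add: c_def power2_eq_square)
    moreover have "inner y y > 0" using False by simp
    ultimately show ?thesis
      by (smt (verit) divide_pos_pos zero_less_power2)
  qed simp
  with q_S show thesis by (rule that)
qed

text \<open>The kernel of a nonzero \<open>f\<close> is a closed hyperplane. Projecting a point
  outside it onto the kernel leaves a normal vector \<open>u\<close>, and subtracting a suitable
  multiple of \<open>u\<close> moves any \<open>y\<close> into the kernel.\<close>

lemma riesz_representation:
  fixes f :: "'a::{real_inner, complete_space} \<Rightarrow> real"
  assumes "bounded_linear f"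
  obtains u where "\<And>x. f x = inner x u"
proof (cases "\<forall>x. f x = 0")
  case True
  then show thesis by (intro that[of 0]) simp
next
  case False
  interpret f: bounded_linear f by fact
  obtain x where "f x \<noteq> 0" using False by blast
  have "subspace {y. f y = 0}"
    by (auto simp: subspace_def f.add f.scaleR f.zero)
  moreover have "closed {y. f y = 0}"
    by (intro closed_Collect_eq f.continuous_on continuous_on_id continuous_on_const)
  ultimately obtain p where p: "f p = 0" "\<And>y. f y = 0 \<Longrightarrow> inner (x - p) y = 0"
    using orthogonal_projection_exists[of "{y. f y = 0}" x] by auto
  define u where "u = x - p"
  have fu: "f u \<noteq> 0" using \<open>f x \<noteq> 0\<close> p(1) by (simp add: u_def f.diff)
  then have u: "u \<noteq> 0" using f.zero by auto
  have "f y = inner y ((f u / inner u u) *\<^sub>R u)" for y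
  proof -
    have "f (y - (f y / f u) *\<^sub>R u) = 0" using fu by (simp add: f.diff f.scaleR)
    then have "inner u (y - (f y / f u) *\<^sub>R u) = 0" using p(2) by (simp add: u_def)
    then have "inner y u = f y / f u * inner u u" by (simp add: inner_diff_right inner_commute)
    then show ?thesis using fu u by simp
  qed
  then show thesis by (rule that)
qed

text \<open>Riesz supplies a function satisfying the defining equation, so the one picked by Hilbert
  choice in \<open>adjoint\<close> satisfies it too.\<close>

lemma adjoint_inner:
  fixes L :: "'a::{real_inner, complete_space} \<Rightarrow> 'b::real_inner"
  assumes "bounded_linear L"
  shows "inner (L x) y = inner x (adjoint L y)"
proof -
  have "\<exists>u. \<forall>x. inner (L x) y = inner x u" for y
    using riesz_representation[OF bounded_linear_compose[OF bounded_linear_inner_left assms]]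
    by metis
  then have "\<exists>f'. \<forall>x y. inner (L x) y = inner x (f' y)" by metis
  then have "\<forall>x y. inner (L x) y = inner x (adjoint L y)"
    unfolding adjoint_def by (rule someI_ex)
  then show ?thesis by blast
qed

text \<open>Tychonoff replaces the diagonal argument: all \<open>g n\<close> lie in a product of
  compact intervals, and with countably many factors compactness yields sequential
  compactness.\<close>

lemma diagonal_convergent_subsequence:
  fixes g :: "nat \<Rightarrow> nat \<Rightarrow> real"
  assumes "\<And>m n. \<bar>g n m\<bar> \<le> C m"
  obtains k where "strict_mono (k :: nat \<Rightarrow> nat)" "\<And>m. convergent (\<lambda>n. g (k n) m)"
proof -
  define K where "K = (\<Pi>\<^sub>E m\<in>UNIV. {- C m..C m})"
  have "compactin (product_topology (\<lambda>_. euclidean) UNIV) K"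
    unfolding K_def compactin_PiE by simp
  then have "compact K" by (simp add: euclidean_product_topology)
  then have "seq_compact K" by (rule compact_imp_seq_compact)
  moreover have "\<forall>n. g n \<in> K"
    using assms by (auto simp: K_def abs_le_iff minus_le_iff)
  ultimately obtain l k where k: "strict_mono k" and lim: "(g \<circ> k) \<longlonglongrightarrow> l"
    by (rule seq_compactE)
  have "(\<lambda>n. g (k n) m) \<longlonglongrightarrow> l m" for m
    using continuous_on_tendsto_compose[OF continuous_on_product_coordinates lim, of m]
    by (simp add: o_def)
  with k show thesis using that convergent_def by blast
qed

text \<open>The vectors against which a bounded sequence converges form a closed subspace. Once that
  subspace contains the whole sequence it is everything, because vectors orthogonal to it have
  vanishing inner products with the sequence.\<close>

lemma weakly_convergent_subsequence:
  fixes z :: "nat \<Rightarrow> 'a::{real_inner, complete_space}"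
  assumes bound: "\<And>n. norm (z n) \<le> C"
  obtains k l where "strict_mono (k :: nat \<Rightarrow> nat)" "weakly_converges (\<lambda>n. z (k n)) l"
proof -
  \<comment> \<open>Testing only against the members of the sequence keeps the family of test
    vectors countable, even if the space is not separable.\<close>
  have "\<bar>inner (z n) (z m)\<bar> \<le> C * norm (z m)" for m n
    by (rule order_trans[OF Cauchy_Schwarz_ineq2]) (simp add: bound mult_right_mono)
  then obtain k where k: "strict_mono k" and conv: "\<And>m. convergent (\<lambda>n. inner (z (k n)) (z m))"
    by (rule diagonal_convergent_subsequence[of "\<lambda>n m. inner (z n) (z m)"]) (rule that)
  define W where "W = {y. convergent (\<lambda>n. inner (z (k n)) y)}"
  have W_subspace: "subspace W"
    by (auto simp: W_def subspace_def inner_add_right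
        intro: convergent_add convergent_mult convergent_const)
  have W_closed: "closed W"
  proof (unfold closed_sequential_limits, intro allI impI, elim conjE)
    fix y l assume y: "\<forall>i. y i \<in> W" and lim: "y \<longlonglongrightarrow> l"
    have "Cauchy (\<lambda>n. inner (z (k n)) l)"
    proof (rule CauchyI)
      fix e :: real assume "e > 0"
      have C: "0 \<le> C" using bound[of 0] norm_ge_zero order_trans by blast
      \<comment> \<open>The \<open>C + 1\<close> avoids division by zero when \<open>C = 0\<close>
        and makes \<open>C * d\<close> less than a third of \<open>e\<close>.\<close>
      define d where "d = e / (3 * (C + 1))"
      have "d > 0" using \<open>e > 0\<close> C by (simp add: d_def)
      then obtain i where i: "norm (y i - l) < d"
        using lim unfolding LIMSEQ_iff by blast
      have close: "\<bar>inner (z (k n)) (y i) - inner (z (k n)) l\<bar> < e / 3" for n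
      proof -
        have "\<bar>inner (z (k n)) (y i - l)\<bar> \<le> norm (z (k n)) * norm (y i - l)"
          by (rule Cauchy_Schwarz_ineq2)
        also have "\<dots> \<le> C * d" using bound i C by (intro mult_mono) auto
        also have "\<dots> < (C + 1) * d" using \<open>d > 0\<close> by simp
        also have "\<dots> = e / 3" using C by (simp add: d_def field_simps)
        finally show ?thesis by (simp add: inner_diff_right)
      qed
      have "Cauchy (\<lambda>n. inner (z (k n)) (y i))"
        using y by (simp add: W_def Cauchy_convergent_iff)
      then obtain M where M: "\<And>m n. m \<ge> M \<Longrightarrow> n \<ge> M \<Longrightarrow>
          norm (inner (z (k m)) (y i) - inner (z (k n)) (y i)) < e / 3"
        using CauchyD[of _ "e / 3"] \<open>e > 0\<close> by (metis divide_pos_pos zero_less_numeral)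
      have "norm (inner (z (k m)) l - inner (z (k n)) l) < e" if "m \<ge> M" "n \<ge> M" for m n
        using M[OF that] close[of m] close[of n] unfolding real_norm_def by linarith
      then show "\<exists>M. \<forall>m\<ge>M. \<forall>n\<ge>M. norm (inner (z (k m)) l - inner (z (k n)) l) < e" by blast
    qed
    then show "l \<in> W" by (simp add: W_def Cauchy_convergent_iff)
  qed
  have "y \<in> W" for y
  proof -
    obtain p where p: "p \<in> W" "\<And>w. w \<in> W \<Longrightarrow> inner (y - p) w = 0"
      by (rule orthogonal_projection_exists[OF W_subspace W_closed]) (rule that)
    have "inner (z (k n)) (y - p) = 0" for n
      using p(2)[of "z (k n)"] conv by (simp add: W_def inner_commute)
    then have "inner (z (k n)) y = inner (z (k n)) p" for n
      by (simp add: inner_diff_right)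
    with p(1) show ?thesis by (simp add: W_def)
  qed
  then obtain f where f: "\<And>y. (\<lambda>n. inner (z (k n)) y) \<longlonglongrightarrow> f y"
    unfolding W_def convergent_def by simp metis
  \<comment> \<open>The pointwise limit functional inherits linearity and the bound
    \<open>C\<close>, so its Riesz vector is the weak limit.\<close>
  have "bounded_linear f"
  proof (rule bounded_linear_intro)
    show "f (y + w) = f y + f w" for y w
      using LIMSEQ_unique[OF f[of "y + w"]] tendsto_add[OF f[of y] f[of w]]
      by (simp add: inner_add_right)
    show "f (r *\<^sub>R y) = r *\<^sub>R f y" for r y
      using LIMSEQ_unique[OF f[of "r *\<^sub>R y"]] tendsto_mult[OF tendsto_const f[of y], of r] by simp
    show "norm (f y) \<le> norm y * C" for y
    proof (rule LIMSEQ_le_const2[OF tendsto_norm[OF f]])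
      have "norm (inner (z (k n)) y) \<le> norm y * C" for n
        using order_trans[OF Cauchy_Schwarz_ineq2 mult_right_mono[OF bound norm_ge_zero]]
        by (simp add: mult.commute)
      then show "\<exists>N. \<forall>n\<ge>N. norm (inner (z (k n)) y) \<le> norm y * C" by blast
    qed
  qed
  then obtain l where "\<And>y. f y = inner y l" by (rule riesz_representation) (rule that)
  then have "weakly_converges (\<lambda>n. z (k n)) l"
    using f by (simp add: weakly_converges_def inner_commute)
  with k show thesis by (rule that)
qed

section \<open>Fejer monotone sequences\<close>

lemma fejer_monotone_norm_convergent:
  assumes "fejer_monotone z C" "p \<in> C"
  shows "convergent (\<lambda>n. norm (z n - p))"
proof -
  have "decseq (\<lambda>n. norm (z n - p))"
    using assms by (intro decseq_SucI) (simp add: fejer_monotone_def)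
  then show ?thesis
    using decseq_convergent[of _ 0] norm_ge_zero unfolding convergent_def by metis
qed

lemma fejer_monotone_bounded:
  assumes "fejer_monotone z C" "p \<in> C"
  obtains K where "\<And>n. norm (z n) \<le> K"
proof -
  obtain K where K: "\<And>n. norm (norm (z n - p)) \<le> K"
    using convergent_imp_Bseq[OF fejer_monotone_norm_convergent[OF assms]] by (meson BseqE)
  have "norm (z n) \<le> K + norm p" for n
    using K[of n] norm_triangle_sub[of "z n" p] by simp
  then show thesis by (rule that)
qed

text \<open>Since \<open>\<parallel>z n - p\<parallel>\<^sup>2 - \<parallel>z n - q\<parallel>\<^sup>2\<close> is affine in \<open>z n\<close>, its limit along the two subsequences
  yields \<open>\<langle>p, p - q\<rangle> = \<langle>q, p - q\<rangle>\<close>.\<close>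

lemma fejer_monotone_weak_cluster_unique:
  fixes z :: "nat \<Rightarrow> 'a::real_inner"
  assumes fejer: "fejer_monotone z C" and "p \<in> C" "q \<in> C"
    and "strict_mono k" "weakly_converges (\<lambda>n. z (k n)) p"
    and "strict_mono j" "weakly_converges (\<lambda>n. z (j n)) q"
  shows "p = q"
proof -
  obtain P Q where "(\<lambda>n. norm (z n - p)) \<longlonglongrightarrow> P" "(\<lambda>n. norm (z n - q)) \<longlonglongrightarrow> Q"
    using fejer_monotone_norm_convergent[OF fejer] assms(2,3) unfolding convergent_def by metis
  then have "(\<lambda>n. ((norm p)\<^sup>2 - (norm q)\<^sup>2 - ((norm (z n - p))\<^sup>2 - (norm (z n - q))\<^sup>2)) / 2)
      \<longlonglongrightarrow> ((norm p)\<^sup>2 - (norm q)\<^sup>2 - (P\<^sup>2 - Q\<^sup>2)) / 2" (is "_ \<longlonglongrightarrow> ?l")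
    by (intro tendsto_intros) auto
  moreover have "((norm p)\<^sup>2 - (norm q)\<^sup>2 - ((norm (z n - p))\<^sup>2 - (norm (z n - q))\<^sup>2)) / 2
      = inner (z n) (p - q)" for n
    by (simp add: power2_norm_eq_inner inner_diff_left inner_diff_right inner_commute)
  ultimately have lim: "(\<lambda>n. inner (z n) (p - q)) \<longlonglongrightarrow> ?l" by simp
  have "?l = inner p (p - q)"
    using LIMSEQ_subseq_LIMSEQ[OF lim assms(4)] assms(5)
    by (intro LIMSEQ_unique) (auto simp: weakly_converges_def o_def)
  moreover have "?l = inner q (p - q)"
    using LIMSEQ_subseq_LIMSEQ[OF lim assms(6)] assms(7)
    by (intro LIMSEQ_unique) (auto simp: weakly_converges_def o_def)
  ultimately have "inner (p - q) (p - q) = 0" by (simp only: inner_diff_left)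
  then show ?thesis by simp
qed

text \<open>If weak convergence to the cluster point \<open>l\<close> failed, some subsequence would
  stay at least \<open>e\<close> away from \<open>l\<close> when tested against some
  \<open>y\<close>. A weakly convergent subsequence of it must again tend to \<open>l\<close>, by
  uniqueness of cluster points in \<open>C\<close>.\<close>

lemma fejer_monotone_weakly_converges:
  fixes z :: "nat \<Rightarrow> 'a::{real_inner, complete_space}"
  assumes fejer: "fejer_monotone z C" and "C \<noteq> {}"
    and cluster: "\<And>k l. strict_mono (k :: nat \<Rightarrow> nat) \<Longrightarrow> weakly_converges (\<lambda>n. z (k n)) l \<Longrightarrow> l \<in> C"
  obtains l where "l \<in> C" "weakly_converges z l"
proof -
  obtain K where K: "\<And>n. norm (z n) \<le> K"
    using fejer \<open>C \<noteq> {}\<close> fejer_monotone_bounded by (metis ex_in_conv)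
  obtain k l where k: "strict_mono k" and l: "weakly_converges (\<lambda>n. z (k n)) l"
    by (rule weakly_convergent_subsequence[OF K])
  have "l \<in> C" using k l by (rule cluster)
  have "(\<lambda>n. inner (z n) y) \<longlonglongrightarrow> inner l y" for y
  proof (rule ccontr)
    assume "\<not> ?thesis"
    then obtain e where "e > 0"
      and "\<forall>N. \<exists>n\<ge>N. e \<le> \<bar>inner (z n) y - inner l y\<bar>"
      by (auto simp: LIMSEQ_iff not_less)
    then have "infinite {n. e \<le> \<bar>inner (z n) y - inner l y\<bar>}"
      by (simp add: infinite_nat_iff_unbounded_le)
    from infinite_enumerate[OF this]
    obtain r :: "nat \<Rightarrow> nat"
      where r: "strict_mono r" "\<And>n. e \<le> \<bar>inner (z (r n)) y - inner l y\<bar>"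
      by auto
    obtain j q where j: "strict_mono j" and "weakly_converges (\<lambda>n. z (r (j n))) q"
      by (rule weakly_convergent_subsequence[OF K])
    then have q: "weakly_converges (\<lambda>n. z ((r \<circ> j) n)) q" by simp
    have rj: "strict_mono (r \<circ> j)" using r(1) j by (rule strict_mono_o)
    have "q = l"
      using cluster[OF rj q] \<open>l \<in> C\<close> rj q k l
      by (rule fejer_monotone_weak_cluster_unique[OF fejer])
    with q have "(\<lambda>n. inner (z ((r \<circ> j) n)) y) \<longlonglongrightarrow> inner l y"
      by (simp add: weakly_converges_def)
    then obtain n where "\<bar>inner (z ((r \<circ> j) n)) y - inner l y\<bar> < e"
      using \<open>e > 0\<close> unfolding LIMSEQ_iff real_norm_def by blast
    then show False using r(2)[of "j n"] by simp
  qed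
  with \<open>l \<in> C\<close> show thesis using that by (simp add: weakly_converges_def)
qed

text \<open>Serves to pass between the product space, where the Fejer argument runs, and the two
  component sequences. Test vectors \<open>(c, 0)\<close> and \<open>(0, c)\<close> isolate the
  components.\<close>

lemma weakly_converges_Pair_iff:
  "weakly_converges (\<lambda>n. (x n, v n)) (y, w) \<longleftrightarrow> weakly_converges x y \<and> weakly_converges v w"
proof
  assume *: "weakly_converges (\<lambda>n. (x n, v n)) (y, w)"
  have "weakly_converges x y"
    unfolding weakly_converges_def
  proof
    fix c show "(\<lambda>n. inner (x n) c) \<longlonglongrightarrow> inner y c"
      using *[unfolded weakly_converges_def, rule_format, of "(c, 0)"] by simp
  qed
  moreover have "weakly_converges v w"
    unfolding weakly_converges_def
  proof
    fix c show "(\<lambda>n. inner (v n) c) \<longlonglongrightarrow> inner w c"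
      using *[unfolded weakly_converges_def, rule_format, of "(0, c)"] by simp
  qed
  ultimately show "weakly_converges x y \<and> weakly_converges v w" ..
next
  assume "weakly_converges x y \<and> weakly_converges v w"
  then show "weakly_converges (\<lambda>n. (x n, v n)) (y, w)"
    unfolding weakly_converges_def by (auto intro: tendsto_add)
qed

text \<open>Expanding the square leaves the cross term \<open>c * inner (z - p) d\<close>, which is
  at least \<open>r * \<Delta>\<^sup>2\<close> because \<open>p\<close> lies in the
  half-space.\<close>

lemma relaxed_halfspace_projection:
  fixes z d p :: "'a::real_inner"
  assumes "inner p d \<le> \<eta>" "d \<noteq> 0" "0 \<le> r"
  defines "\<Delta> \<equiv> max 0 ((inner z d - \<eta>) / norm d)"
  shows "(norm (z - (r * \<Delta> / norm d) *\<^sub>R d - p))\<^sup>2 \<le> (norm (z - p))\<^sup>2 - r * (2 - r) * \<Delta>\<^sup>2"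
proof -
  define c where "c = r * \<Delta> / norm d"
  have d: "norm d > 0" using assms(2) by simp
  have "0 \<le> c" using assms(3) by (simp add: c_def \<Delta>_def)
  \<comment> \<open>The factor \<open>c\<close> is kept because without it the inequality can fail
    when \<open>\<Delta> = 0\<close>; there \<open>c\<close> vanishes as well.\<close>
  have "c * (norm d * \<Delta>) \<le> c * inner (z - p) d"
  proof (cases "\<Delta> = 0")
    case False
    then have "norm d * \<Delta> = inner z d - \<eta>"
      using d by (auto simp: \<Delta>_def max_def split: if_splits)
    then show ?thesis
      using assms(1) \<open>0 \<le> c\<close> by (intro mult_left_mono) (auto simp: inner_diff_left)
  qed (simp add: c_def)
  moreover have "c * norm d = r * \<Delta>" using d by (simp add: c_def)
  ultimately have "r * \<Delta>\<^sup>2 \<le> c * inner (z - p) d"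
    by (metis mult.assoc power2_eq_square)
  moreover have "(norm (z - c *\<^sub>R d - p))\<^sup>2
      = (norm (z - p))\<^sup>2 - 2 * (c * inner (z - p) d) + (c * norm d)\<^sup>2"
    unfolding power_mult_distrib power2_norm_eq_inner
    by (simp add: inner_diff_left inner_diff_right inner_commute power2_eq_square algebra_simps)
  ultimately show ?thesis
    unfolding c_def[symmetric] \<open>c * norm d = r * \<Delta>\<close>
    by (simp add: power_mult_distrib algebra_simps power2_eq_square)
qed

section \<open>The Kuhn-Tucker set\<close>

text \<open>Turns the existence of a primal solution into nonemptiness of the Kuhn-Tucker set, and
  later shows that the weak limit is primal optimal.\<close>

lemma primal_solutions_kuhn_tucker:
  "y \<in> primal_solutions A B L \<longleftrightarrow> (\<exists>w. (y, w) \<in> kuhn_tucker A B L)"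
proof -
  have "0 = c + adjoint L w \<longleftrightarrow> c = - adjoint L w" for c w
    by (metis eq_neg_iff_add_eq_0)
  then show ?thesis
    unfolding primal_solutions_def kuhn_tucker_def op_inverse_def set_plus_def by auto
qed

lemma kuhn_tucker_dual_solutions:
  assumes "(y, w) \<in> kuhn_tucker A B L"
  shows "w \<in> dual_solutions A B L"
proof -
  have "- L y \<in> uminus ` L ` op_inverse A (- adjoint L w)" "L y \<in> op_inverse B w"
    using assms by (auto simp: kuhn_tucker_def op_inverse_def)
  from set_plus_intro[OF this] show ?thesis by (simp add: dual_solutions_def)
qed

text \<open>Add the monotonicity inequalities of \<open>A\<close> and \<open>B\<close> at the chosen
  graph points and at those given by \<open>p = (y, w)\<close>. The terms
  \<open>inner y (adjoint L w)\<close> and \<open>inner (L y) w\<close> cancel, which leaves a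
  condition affine in \<open>p\<close>.\<close>

lemma kuhn_tucker_halfspace:
  fixes A :: "'a::{real_inner, complete_space} \<Rightarrow> 'a set" and B :: "'b::real_inner \<Rightarrow> 'b set"
  assumes "monotone_operator A" "monotone_operator B" "bounded_linear L"
    and "(a, a') \<in> gra A" "(b, b') \<in> gra B" "p \<in> kuhn_tucker A B L"
  shows "inner p (a' + adjoint L b', b - L a) \<le> inner a a' + inner b b'"
proof -
  obtain y w where p: "p = (y, w)" by (cases p)
  with assms(6) have "(y, - adjoint L w) \<in> gra A" "(L y, w) \<in> gra B"
    by (auto simp: kuhn_tucker_def gra_def op_inverse_def)
  then have "0 \<le> inner (a - y) (a' - - adjoint L w)" "0 \<le> inner (b - L y) (b' - w)"
    using assms(1,2,4,5) unfolding monotone_operator_def by blast+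
  then show ?thesis
    by (simp add: p inner_simps adjoint_inner[OF assms(3), symmetric] inner_commute
        linear_diff[OF bounded_linear.linear[OF assms(3)]])
qed

theorem proposition3p2:
  fixes A :: "'h::{real_inner, complete_space} \<Rightarrow> 'h set"
    and B :: "'g::{real_inner, complete_space} \<Rightarrow> 'g set"
    and L :: "'h \<Rightarrow> 'g"
    and x0 :: 'h and v0 :: 'g
    and x a astar sstar :: "nat \<Rightarrow> 'h"
    and v b bstar t :: "nat \<Rightarrow> 'g"
    and \<sigma> lam \<Delta> \<theta> :: "nat \<Rightarrow> real"
  assumes "maximally_monotone A" and "maximally_monotone B" and "bounded_linear L"
    and "primal_solutions A B L \<noteq> {}"
    and "x 0 = x0" and "v 0 = v0"
    (* step n is executed iff no earlier step has terminated; entries of the sequences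
       that belong to steps which are never executed are unconstrained *)
    and choices: "\<And>n. (\<forall>k<n. \<sigma> k > 0) \<Longrightarrow>
          (a n, astar n) \<in> gra A \<and> (b n, bstar n) \<in> gra B \<and>
          sstar n = astar n + adjoint L (bstar n) \<and>
          t n = b n - L (a n) \<and>
          \<sigma> n = sqrt ((norm (sstar n))\<^sup>2 + (norm (t n))\<^sup>2)"
    and updates: "\<And>n. (\<forall>k<n. \<sigma> k > 0) \<Longrightarrow> \<sigma> n > 0 \<Longrightarrow>
          0 < lam n \<and> lam n < 2 \<and>
          \<Delta> n = max 0 ((inner (x n) (sstar n) + inner (t n) (v n)
                          - inner (a n) (astar n) - inner (b n) (bstar n)) / \<sigma> n) \<and>
          \<theta> n = lam n * \<Delta> n / \<sigma> n \<and>
          x (Suc n) = x n - \<theta> n *\<^sub>R sstar n \<and>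
          v (Suc n) = v n - \<theta> n *\<^sub>R t n"
  shows "(\<exists>N xbar vbar. (\<forall>n<N. \<sigma> n > 0) \<and> \<sigma> N = 0 \<and> xbar = a N \<and> vbar = bstar N \<and>
            (xbar, vbar) \<in> kuhn_tucker A B L)
       \<or> ((\<forall>n. \<sigma> n > 0) \<and>
          fejer_monotone (\<lambda>n. (x n, v n)) (kuhn_tucker A B L) \<and>
          summable (\<lambda>n. lam n * (2 - lam n) * (\<Delta> n)\<^sup>2) \<and>
          ((\<forall>y w k. strict_mono (k :: nat \<Rightarrow> nat) \<longrightarrow>
                weakly_converges (\<lambda>n. x (k n)) y \<longrightarrow> weakly_converges (\<lambda>n. v (k n)) w \<longrightarrow>
                (y, w) \<in> kuhn_tucker A B L)
           \<longrightarrow> (\<exists>xbar vbar. weakly_converges x xbar \<and> xbar \<in> primal_solutions A B L \<and>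
                  weakly_converges v vbar \<and> vbar \<in> dual_solutions A B L \<and>
                  (xbar, vbar) \<in> kuhn_tucker A B L)))"
proof (cases "\<forall>n. \<sigma> n > 0")
  case False
  \<comment> \<open>Taking the first such index ensures that step \<open>N\<close> is executed, so
    \<open>choices\<close> applies to it.\<close>
  define N where "N = (LEAST n. \<not> \<sigma> n > 0)"
  have N: "\<not> \<sigma> N > 0" using False LeastI_ex[of "\<lambda>n. \<not> \<sigma> n > 0"] by (simp add: N_def)
  have before: "\<forall>n<N. \<sigma> n > 0" using not_less_Least unfolding N_def by blast
  note step = choices[OF before]
  \<comment> \<open>As a norm in the product space, \<open>\<sigma> N\<close> is nonnegative, and
    its vanishing forces both residuals \<open>sstar N\<close> and \<open>t N\<close> to
    vanish.\<close>
  have \<sigma>: "\<sigma> N = norm (sstar N, t N)" using step by (simp add: norm_Pair)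
  with N have "(sstar N, t N) = 0" by simp
  with step have "adjoint L (bstar N) = - astar N" "L (a N) = b N"
    by (auto simp: zero_prod_def add_eq_0_iff)
  with step have "(a N, bstar N) \<in> kuhn_tucker A B L"
    by (simp add: kuhn_tucker_def op_inverse_def gra_def)
  moreover have "\<sigma> N = 0" using N \<sigma> by simp
  ultimately show ?thesis using before by blast
next
  case True
  let ?Z = "kuhn_tucker A B L"
  let ?z = "\<lambda>n. (x n, v n)"
  let ?\<epsilon> = "\<lambda>n. lam n * (2 - lam n) * (\<Delta> n)\<^sup>2"
  have mono: "monotone_operator A" "monotone_operator B"
    using assms(1,2) by (auto simp: maximally_monotone_def)
  have lam: "0 < lam n" "lam n < 2" for n using updates[of n] True by auto
  have decrease: "(norm (?z (Suc n) - p))\<^sup>2 \<le> (norm (?z n - p))\<^sup>2 - ?\<epsilon> n" if "p \<in> ?Z" for p n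
  proof -
    have ch: "(a n, astar n) \<in> gra A" "(b n, bstar n) \<in> gra B"
      "sstar n = astar n + adjoint L (bstar n)" "t n = b n - L (a n)"
      "\<sigma> n = sqrt ((norm (sstar n))\<^sup>2 + (norm (t n))\<^sup>2)"
      using choices[of n] True by auto
    have up: "\<Delta> n = max 0 ((inner (x n) (sstar n) + inner (t n) (v n)
          - inner (a n) (astar n) - inner (b n) (bstar n)) / \<sigma> n)"
      "\<theta> n = lam n * \<Delta> n / \<sigma> n"
      "x (Suc n) = x n - \<theta> n *\<^sub>R sstar n" "v (Suc n) = v n - \<theta> n *\<^sub>R t n"
      using updates[of n] True by auto
    \<comment> \<open>In the product space the updates of \<open>x\<close> and \<open>v\<close> form
      a single step along \<open>d\<close>.\<close>
    define d where "d = (sstar n, t n)"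
    define \<eta> where "\<eta> = inner (a n) (astar n) + inner (b n) (bstar n)"
    have \<sigma>: "\<sigma> n = norm d" using ch by (simp add: d_def norm_Pair)
    then have "d \<noteq> 0" using True[rule_format, of n] by auto
    moreover have "inner p d \<le> \<eta>"
      using kuhn_tucker_halfspace[OF mono assms(3) ch(1,2) that] ch(3,4) by (simp add: d_def \<eta>_def)
    moreover have "\<Delta> n = max 0 ((inner (?z n) d - \<eta>) / norm d)"
      using up(1) \<sigma> by (simp add: d_def \<eta>_def inner_commute diff_diff_eq)
    moreover have "?z (Suc n) = ?z n - (lam n * \<Delta> n / norm d) *\<^sub>R d"
      using up(2-) \<sigma> by (simp add: d_def)
    ultimately show ?thesis
      using relaxed_halfspace_projection[of p d \<eta> "lam n" "?z n"] lam(1)[of n] by simp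
  qed
  have nonneg: "0 \<le> ?\<epsilon> n" for n using lam[of n] by simp
  have fejer: "fejer_monotone ?z ?Z"
    unfolding fejer_monotone_def
  proof (intro ballI allI)
    fix p n assume "p \<in> ?Z"
    show "norm (?z (Suc n) - p) \<le> norm (?z n - p)"
      using decrease[OF \<open>p \<in> ?Z\<close>, of n] nonneg[of n]
      by - (rule power2_le_imp_le[OF _ norm_ge_zero], linarith)
  qed
  have "?Z \<noteq> {}" using assms(4) primal_solutions_kuhn_tucker by (metis ex_in_conv)
  then obtain p where p: "p \<in> ?Z" by blast
  \<comment> \<open>The decrease estimate telescopes for one fixed Kuhn-Tucker point, bounding all
    partial sums by the initial squared distance.\<close>
  have "(\<Sum>i<n. ?\<epsilon> i) \<le> (norm (?z 0 - p))\<^sup>2 - (norm (?z n - p))\<^sup>2" for n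
  proof (induction n)
    case (Suc n)
    then show ?case using decrease[OF p, of n] by simp
  qed simp
  then have "(\<Sum>i<n. ?\<epsilon> i) \<le> (norm (?z 0 - p))\<^sup>2" for n
    by (smt (verit) zero_le_power2)
  then have summable: "summable ?\<epsilon>"
    using nonneg by (intro summableI_nonneg_bounded)
  have "\<exists>xbar vbar. weakly_converges x xbar \<and> xbar \<in> primal_solutions A B L \<and>
      weakly_converges v vbar \<and> vbar \<in> dual_solutions A B L \<and> (xbar, vbar) \<in> ?Z"
    if cluster: "\<forall>y w k. strict_mono (k :: nat \<Rightarrow> nat) \<longrightarrow>
        weakly_converges (\<lambda>n. x (k n)) y \<longrightarrow> weakly_converges (\<lambda>n. v (k n)) w \<longrightarrow> (y, w) \<in> ?Z"
  proof -
    obtain l where l: "l \<in> ?Z" "weakly_converges ?z l"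
    proof (rule fejer_monotone_weakly_converges[OF fejer \<open>?Z \<noteq> {}\<close>])
      fix k :: "nat \<Rightarrow> nat" and l
      assume "strict_mono k" "weakly_converges (\<lambda>n. ?z (k n)) l"
      then show "l \<in> ?Z"
        using cluster by (cases l) (auto simp: weakly_converges_Pair_iff)
    qed
    obtain xbar vbar where "l = (xbar, vbar)" by (cases l)
    with l show ?thesis
      using primal_solutions_kuhn_tucker kuhn_tucker_dual_solutions
      by (metis weakly_converges_Pair_iff)
  qed
  with True fejer summable show ?thesis by blast
qed

end
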